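(* Let $n\ge 2$ and consider the Kreweras complement $\mathcal{K}$ (equivalently its inverse) acting on $S_n$. Then: (1) if $n$ is odd, the permutation $\frac{n+3}{2}\,\frac{n+5}{2}\cdots n\,1\,2\,3\cdots\frac{n+1}{2}$ (one-line notation) forms the unique orbit of size $1$; if $n$ is even there is no orbit of size $1$; (2) there are exactly $\lfloor n/2\rfloor$ orbits of size $2$, one of which is the orbit of the identity permutation; (3) the permutation $n(n-1)\cdots 321$ generates an orbit of size $n$; (4) for even $n>3$, the permutation $1\,3\,5\cdots(n-1)\,2\,4\cdots n$ generates an orbit of size $2n$, and for odd $n>3$, the permutation $1\,3\,5\cdots n\,2\,4\cdots(n-1)$ generates an orbit of size $2n$.
   Context: Permutations are in one-line notation and composed right to left. Let $c=234\cdots n1\in S_n$ (i.e. $c(i)=i+1$ for $i<n$, $c(n)=1$). The Kreweras complement is $\mathcal{K}:S_n\to S_n$, $\mathcal{K}(\sigma)=c\circ\sigma^{-1}$, with inverse $\mathcal{K}^{-1}(\sigma)=\sigma^{-1}\circ c$; orbits of $\mathcal{K}$ and $\mathcal{K}^{-1}$ coincide. *)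

theory Defs
  imports "HOL-Combinatorics.Combinatorics"
begin

text \<open>
  \<open>S\<^sub>n\<close> is the set of functions on \<^typ>\<open>nat\<close> that permute \<open>{1..n}\<close> (and are the identity
  elsewhere), so composition is \<open>\<circ>\<close> (right to left) and inversion is \<^const>\<open>inv\<close>.
\<close>

definition Sn :: "nat \<Rightarrow> (nat \<Rightarrow> nat) set" where
  "Sn n = {\<sigma>. \<sigma> permutes {1..n}}"

text \<open>The list index starts at 0, positions in one-line notation at 1.\<close>

definition one_line :: "nat list \<Rightarrow> nat \<Rightarrow> nat" where
  "one_line w i = (if i \<in> {1..length w} then w ! (i - 1) else i)"

definition long_cycle :: "nat \<Rightarrow> nat \<Rightarrow> nat" where
  "long_cycle n = one_line ([2..<n+1] @ [1])"

definition kreweras :: "nat \<Rightarrow> (nat \<Rightarrow> nat) \<Rightarrow> (nat \<Rightarrow> nat)" where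
  "kreweras n \<sigma> = long_cycle n \<circ> inv \<sigma>"

definition kreweras_inv :: "nat \<Rightarrow> (nat \<Rightarrow> nat) \<Rightarrow> (nat \<Rightarrow> nat)" where
  "kreweras_inv n \<sigma> = inv \<sigma> \<circ> long_cycle n"

text \<open>
  The library's \<^term>\<open>orbit F \<sigma>\<close> collects the iterates of \<open>F\<close> at \<open>\<sigma>\<close> with positive exponent.
  For both maps above this is the usual orbit of \<open>\<sigma> \<in> S\<^sub>n\<close>: see \<open>self_in_orbit_kreweras\<close>,
  \<open>self_in_orbit_kreweras_inv\<close> and \<open>orbit_kreweras_inv\<close> below.
\<close>

definition orbits_on :: "('a \<Rightarrow> 'a) \<Rightarrow> 'a set \<Rightarrow> 'a set set" where
  "orbits_on F S = orbit F ` S"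

lemma long_cycle_eq:
  "n \<ge> 1 \<Longrightarrow> long_cycle n i = (if 1 \<le> i \<and> i < n then i + 1 else if i = n then 1 else i)"
  by (auto simp: long_cycle_def one_line_def nth_append)

lemma long_cycle_permutes:
  assumes "n \<ge> 1"
  shows "long_cycle n permutes {1..n}"
proof (rule bij_imp_permutes)
  have "inj_on (long_cycle n) {1..n}"
    using assms by (auto simp: inj_on_def long_cycle_eq split: if_splits)
  moreover have "long_cycle n ` {1..n} \<subseteq> {1..n}"
    using assms by (auto simp: long_cycle_eq)
  ultimately show "bij_betw (long_cycle n) {1..n} {1..n}"
    by (simp add: bij_betw_def endo_inj_surj)
  show "long_cycle n i = i" if "i \<notin> {1..n}" for i
    using that assms by (auto simp: long_cycle_eq)
qed

lemma finite_Sn: "finite (Sn n)"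
  by (simp add: Sn_def finite_permutations)

lemma kreweras_in_Sn: "n \<ge> 1 \<Longrightarrow> \<sigma> \<in> Sn n \<Longrightarrow> kreweras n \<sigma> \<in> Sn n"
  unfolding Sn_def kreweras_def by (blast intro: permutes_compose permutes_inv long_cycle_permutes)

lemma kreweras_inv_in_Sn: "n \<ge> 1 \<Longrightarrow> \<sigma> \<in> Sn n \<Longrightarrow> kreweras_inv n \<sigma> \<in> Sn n"
  unfolding Sn_def kreweras_inv_def by (blast intro: permutes_compose permutes_inv long_cycle_permutes)

lemma kreweras_inv_kreweras:
  assumes "n \<ge> 1" "\<sigma> \<in> Sn n"
  shows "kreweras_inv n (kreweras n \<sigma>) = \<sigma>"
proof -
  have c: "bij (long_cycle n)" and s: "bij \<sigma>"
    using assms long_cycle_permutes permutes_bij by (auto simp: Sn_def)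
  have "inv (long_cycle n \<circ> inv \<sigma>) = \<sigma> \<circ> inv (long_cycle n)"
    using c s by (simp add: o_inv_distrib bij_imp_bij_inv inv_inv_eq)
  then show ?thesis
    using c by (simp add: kreweras_def kreweras_inv_def o_assoc[symmetric] bij_is_inj)
qed

lemma kreweras_kreweras_inv:
  assumes "n \<ge> 1" "\<sigma> \<in> Sn n"
  shows "kreweras n (kreweras_inv n \<sigma>) = \<sigma>"
proof -
  have c: "bij (long_cycle n)" and s: "bij \<sigma>"
    using assms long_cycle_permutes permutes_bij by (auto simp: Sn_def)
  have "inv (inv \<sigma> \<circ> long_cycle n) = inv (long_cycle n) \<circ> \<sigma>"
    using c s by (simp add: o_inv_distrib bij_imp_bij_inv inv_inv_eq)
  then show ?thesis
    using c by (simp add: kreweras_def kreweras_inv_def o_assoc surj_iff[THEN iffD1] bij_is_surj)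
qed

lemma orbit_subset_invariant:
  assumes "\<And>x. x \<in> S \<Longrightarrow> F x \<in> S" "x \<in> S"
  shows "orbit F x \<subseteq> S"
proof
  fix y assume "y \<in> orbit F x"
  then show "y \<in> S" by induction (use assms in auto)
qed

lemma self_in_orbit_finite:
  assumes "finite S" "\<And>x. x \<in> S \<Longrightarrow> F x \<in> S" "\<And>x. x \<in> S \<Longrightarrow> G (F x) = x" "x \<in> S"
  shows "x \<in> orbit F x"
proof -
  have sub: "orbit F x \<subseteq> S" by (rule orbit_subset_invariant) (use assms in auto)
  have "inj_on F (orbit F x)" by (rule inj_on_inverseI[of _ G]) (use sub assms(3) in blast)
  moreover have "F ` orbit F x \<subseteq> orbit F x" by (auto intro: orbit.intros)
  ultimately have "F ` orbit F x = orbit F x"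
    using endo_inj_surj finite_subset[OF sub assms(1)] by blast
  then obtain y where "y \<in> orbit F x" "F y = F x"
    by (metis imageE orbit.base)
  then show ?thesis using sub assms(3,4) by (metis subsetD)
qed

lemma orbit_inverse_subset:
  assumes "finite S" "\<And>x. x \<in> S \<Longrightarrow> F x \<in> S" "\<And>x. x \<in> S \<Longrightarrow> G (F x) = x" "x \<in> S"
  shows "orbit G x \<subseteq> orbit F x"
proof (rule orbit_subset_invariant)
  show self: "x \<in> orbit F x" using self_in_orbit_finite[of S F G x] assms by blast
  have sub: "orbit F x \<subseteq> S" by (rule orbit_subset_invariant) (use assms in auto)
  show "G y \<in> orbit F x" if "y \<in> orbit F x" for y
    using that by cases (use self sub assms(3,4) in auto)
qed

lemma self_in_orbit_kreweras: "n \<ge> 1 \<Longrightarrow> \<sigma> \<in> Sn n \<Longrightarrow> \<sigma> \<in> orbit (kreweras n) \<sigma>"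
  by (rule self_in_orbit_finite[OF finite_Sn kreweras_in_Sn kreweras_inv_kreweras])

lemma self_in_orbit_kreweras_inv: "n \<ge> 1 \<Longrightarrow> \<sigma> \<in> Sn n \<Longrightarrow> \<sigma> \<in> orbit (kreweras_inv n) \<sigma>"
  by (rule self_in_orbit_finite[OF finite_Sn kreweras_inv_in_Sn kreweras_kreweras_inv])

lemma orbit_kreweras_inv:
  assumes "n \<ge> 1" "\<sigma> \<in> Sn n"
  shows "orbit (kreweras_inv n) \<sigma> = orbit (kreweras n) \<sigma>"
  using orbit_inverse_subset[OF finite_Sn kreweras_in_Sn kreweras_inv_kreweras]
    orbit_inverse_subset[OF finite_Sn kreweras_inv_in_Sn kreweras_kreweras_inv] assms
  by blast

end

theory Submission
  imports Defs "HOL-Number_Theory.Cong"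
begin

text \<open>
  The square of \<open>K\<close> is conjugation by \<open>c\<close>, so an orbit has at most two elements iff it consists of
  elements of the centraliser of \<open>c\<close>, that is, of powers of \<open>c\<close>. As \<open>K (c\<^sup>k) = c\<^bsup>n+1-k\<^esup>\<close>, the
  orbits of size at most 2 are the pairs \<open>{c\<^sup>k, c\<^bsup>n+1-k\<^esup>}\<close>, with a fixed point iff \<open>2k = n + 1\<close>.
  On the reversal \<open>\<rho>\<close> the iterates are the reflections \<open>c\<^sup>m \<circ> \<rho>\<close>. For the permutation \<open>u\<close>
  listing first the odd and then the even numbers, \<open>K\<^bsup>2j\<^esup> u = u\<close> means that \<open>c\<^sup>j\<close> commutes
  with \<open>u\<close>; then \<open>j + 1\<close> is a fixed point of \<open>u\<close> modulo \<open>n\<close>, and \<open>u\<close> fixes at most \<open>1\<close> and \<open>n\<close>.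
  Further, \<open>K\<^bsup>2j+1\<^esup> u = u\<close> means \<open>c\<^bsup>j+1\<^esup> = u \<circ> c\<^sup>j \<circ> u\<close>: for even \<open>n\<close> this makes \<open>u\<close> commute
  with \<open>c\<^bsup>2j+1\<^esup>\<close>, which was just excluded, and for odd \<open>n\<close>, where \<open>u i = 2i - 1\<close> modulo \<open>n\<close>, it
  forces \<open>n\<close> to divide \<open>3\<close>.
\<close>

section \<open>Orbit size as least positive period\<close>

lemma card_orbit_eq_iff:
  assumes "x \<in> orbit F x" "N > 0"
  shows "card (orbit F x) = N \<longleftrightarrow> (F ^^ N) x = x \<and> (\<forall>m. 0 < m \<and> m < N \<longrightarrow> (F ^^ m) x \<noteq> x)"
proof -
  \<comment> \<open>The iterates before the first return to \<open>x\<close> are distinct and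
    exhaust the orbit, so its cardinality is the first return time.\<close>
  have card: "card (orbit F x) = funpow_dist1 F x x"
    using orbit_conv_funpow_dist1[OF assms(1)] card_image[OF inj_on_funpow_dist1[OF assms(1)]]
    by simp
  have "(F ^^ funpow_dist1 F x x) x = x"
    by (rule funpow_dist1_prop[OF assms(1)])
  moreover have "(F ^^ m) x \<noteq> x" if "0 < m" "m < funpow_dist1 F x x" for m
    using that by (rule funpow_dist1_least)
  ultimately show ?thesis
    unfolding card using assms(2) by (metis linorder_neqE_nat zero_less_Suc)
qed

lemma card_orbit_eq_1_iff: "x \<in> orbit F x \<Longrightarrow> card (orbit F x) = 1 \<longleftrightarrow> F x = x"
  by (auto simp: card_orbit_eq_iff)

lemma card_orbit_eq_2_iff:
  "x \<in> orbit F x \<Longrightarrow> card (orbit F x) = 2 \<longleftrightarrow> F (F x) = x \<and> F x \<noteq> x"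
  by (auto simp: card_orbit_eq_iff numeral_2_eq_2 less_Suc_eq)

lemma orbit_involutive: "F (F x) = x \<Longrightarrow> orbit F x = {x, F x}"
proof
  assume "F (F x) = x"
  show "orbit F x \<subseteq> {x, F x}"
    by (rule orbit_subset_invariant) (use \<open>F (F x) = x\<close> in auto)
  show "{x, F x} \<subseteq> orbit F x"
    using orbit.base[of F x] orbit.step[OF orbit.base, of F x] \<open>F (F x) = x\<close> by auto
qed

section \<open>Powers of the long cycle as translations modulo n\<close>

lemma funpow_commute: "f \<circ> g = g \<circ> f \<Longrightarrow> (f ^^ k) \<circ> g = g \<circ> (f ^^ k)"
  by (induction k) (auto simp: fun_eq_iff)

text \<open>The representatives are 1 to n, with n in the role of 0; shifting by one reaches the
  standard residues 0 to n - 1.\<close>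

lemma cong_atLeast1_imp_eq:
  fixes x y n :: nat
  assumes "[x = y] (mod n)" "x \<in> {1..n}" "y \<in> {1..n}"
  shows "x = y"
proof -
  have "[x - 1 = y - 1] (mod n)"
    using assms by (intro cong_diff_nat) auto
  then show ?thesis
    using assms(2,3) by (auto dest!: cong_less_modulus_unique_nat)
qed

lemma long_cycle_funpow:
  assumes "i \<in> {1..n}"
  shows "(long_cycle n ^^ k) i = (i - 1 + k) mod n + 1"
proof (induction k)
  case 0
  then show ?case using assms by auto
next
  case (Suc k)
  let ?r = "(i - 1 + k) mod n"
  have "?r < n" using assms by auto
  then have "long_cycle n (?r + 1) = (i - 1 + Suc k) mod n + 1"
    by (simp add: long_cycle_eq mod_Suc)
  then show ?case using Suc by simp
qed

lemma long_cycle_funpow_permutes: "n \<ge> 1 \<Longrightarrow> (long_cycle n ^^ k) permutes {1..n}"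
  by (induction k) (simp_all only: funpow.simps permutes_id permutes_compose long_cycle_permutes)

lemma long_cycle_funpow_cong:
  assumes "i \<in> {1..n}"
  shows "[(long_cycle n ^^ k) i = i + k] (mod n)"
proof -
  have "[(i - 1 + k) mod n + 1 = (i - 1 + k) + 1] (mod n)"
    by (intro cong_add) auto
  then show ?thesis using assms by (simp add: long_cycle_funpow)
qed

text \<open>Lets permutations of \<open>{1..n}\<close> be compared modulo n, where
  \<open>long_cycle n\<close> is just the addition of 1.\<close>

lemma permutes_atLeastAtMost_eqI:
  fixes n :: nat
  assumes "f permutes {1..n}" "g permutes {1..n}" "\<And>i. i \<in> {1..n} \<Longrightarrow> [f i = g i] (mod n)"
  shows "f = g"
proof
  fix i
  show "f i = g i"
  proof (cases "i \<in> {1..n}")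
    case True
    then show ?thesis
      using assms by (intro cong_atLeast1_imp_eq[of _ _ n]) (auto simp only: permutes_in_image)
  next
    case False
    then show ?thesis using assms(1,2) by (metis permutes_not_in)
  qed
qed

lemma long_cycle_funpow_eq_id: "n \<ge> 1 \<Longrightarrow> n dvd k \<Longrightarrow> long_cycle n ^^ k = id"
proof (rule permutes_atLeastAtMost_eqI[of _ n])
  fix i assume "n dvd k" and i: "i \<in> {1..n}"
  then have "[i + k = id i] (mod n)"
    by (auto simp: cong_def elim!: dvdE)
  then show "[(long_cycle n ^^ k) i = id i] (mod n)"
    using long_cycle_funpow_cong[OF i] cong_trans by blast
qed (simp_all only: long_cycle_funpow_permutes permutes_id)

text \<open>Since n is the zero residue, the value at n recovers the exponent; hence distinct
  exponents in \<open>{1..n}\<close> give distinct powers.\<close>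

lemma long_cycle_funpow_last: "k \<in> {1..n} \<Longrightarrow> (long_cycle n ^^ k) n = k"
  by (rule cong_atLeast1_imp_eq[of _ _ n])
    (auto simp: long_cycle_funpow Suc_le_eq cong_def mod_Suc_eq)

lemma inj_on_long_cycle_funpow:
  fixes n :: nat
  shows "inj_on (\<lambda>k. long_cycle n ^^ k) {1..n}"
  by (metis (mono_tags, lifting) inj_onI long_cycle_funpow_last)

text \<open>The powers of c move n to every point, so a permutation commuting with c is determined
  by its value at n: from \<open>i = (long_cycle n ^^ i) n\<close> follows
  \<open>\<sigma> i = (long_cycle n ^^ i) (\<sigma> n)\<close>, which is
  \<open>\<sigma> n + i\<close> modulo n.\<close>

lemma commutes_long_cycle_imp_funpow:
  assumes "n \<ge> 1" "\<sigma> permutes {1..n}" "long_cycle n \<circ> \<sigma> = \<sigma> \<circ> long_cycle n"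
  shows "\<sigma> = long_cycle n ^^ \<sigma> n"
proof -
  have range: "\<sigma> n \<in> {1..n}"
    using assms by (simp add: permutes_in_image del: atLeastAtMost_iff) auto
  show ?thesis
  proof (rule permutes_atLeastAtMost_eqI[of _ n])
    fix i assume i: "i \<in> {1..n}"
    have "\<sigma> i = \<sigma> ((long_cycle n ^^ i) n)"
      using i by (simp only: long_cycle_funpow_last)
    also have "\<dots> = (long_cycle n ^^ i) (\<sigma> n)"
      using funpow_commute[OF assms(3), of i] by (metis comp_apply)
    also have "[\<dots> = \<sigma> n + i] (mod n)"
      by (rule long_cycle_funpow_cong[OF range])
    also have "[\<sigma> n + i = (long_cycle n ^^ \<sigma> n) i] (mod n)"
      using long_cycle_funpow_cong[OF i, of "\<sigma> n"] by (simp add: cong_sym add.commute)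
    finally show "[\<sigma> i = (long_cycle n ^^ \<sigma> n) i] (mod n)" .
  qed (use assms long_cycle_funpow_permutes in auto)
qed

lemma inv_long_cycle_funpow:
  assumes "n \<ge> 1" "n dvd k + l"
  shows "inv (long_cycle n ^^ k) = long_cycle n ^^ l"
  using assms long_cycle_funpow_eq_id[of n "k + l"]
  by (intro inv_unique_comp) (auto simp flip: funpow_add simp: add.commute)

section \<open>The complement on powers of c, and its even iterates\<close>

lemma kreweras_long_cycle_funpow:
  assumes "k \<in> {1..n}"
  shows "kreweras n (long_cycle n ^^ k) = long_cycle n ^^ (n + 1 - k)"
proof -
  \<comment> \<open>The exponent \<open>n - k\<close> may be 0; the further factor c of the
    complement brings it back into \<open>{1..n}\<close>.\<close>
  have "inv (long_cycle n ^^ k) = long_cycle n ^^ (n - k)"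
    using assms by (intro inv_long_cycle_funpow) auto
  then show ?thesis
    using assms by (simp add: kreweras_def Suc_diff_le)
qed

lemma kreweras_twice:
  assumes "n \<ge> 1" "\<sigma> \<in> Sn n"
  shows "kreweras n (kreweras n \<sigma>) = long_cycle n \<circ> \<sigma> \<circ> inv (long_cycle n)"
proof -
  have "bij (long_cycle n)" "bij \<sigma>"
    using assms long_cycle_permutes permutes_bij by (auto simp: Sn_def)
  then show ?thesis
    by (simp add: kreweras_def o_inv_distrib bij_imp_bij_inv inv_inv_eq o_assoc)
qed

lemma kreweras_funpow_in_Sn: "n \<ge> 1 \<Longrightarrow> \<sigma> \<in> Sn n \<Longrightarrow> (kreweras n ^^ k) \<sigma> \<in> Sn n"
  by (induction k) (auto intro: kreweras_in_Sn)

text \<open>Two applications conjugate by c, so \<open>2 * j\<close> of them conjugate by its j-th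
  power; multiplying out on the right keeps inverses of powers away.\<close>

lemma kreweras_funpow_double:
  assumes "n \<ge> 1" "\<sigma> \<in> Sn n"
  shows "(kreweras n ^^ (2 * j)) \<sigma> \<circ> long_cycle n ^^ j = long_cycle n ^^ j \<circ> \<sigma>"
proof (induction j)
  case 0
  then show ?case by simp
next
  case (Suc j)
  let ?c = "long_cycle n" and ?t = "(kreweras n ^^ (2 * j)) \<sigma>"
  have t: "?t \<in> Sn n"
    by (rule kreweras_funpow_in_Sn[OF assms])
  have "inv ?c \<circ> ?c = id"
    using long_cycle_permutes[OF assms(1)] by (simp add: permutes_inv_o)
  then have "kreweras n (kreweras n ?t) \<circ> ?c = ?c \<circ> ?t"
    using kreweras_twice[OF assms(1) t] by (simp add: o_assoc[symmetric])
  then have "kreweras n (kreweras n ?t) \<circ> ?c \<circ> ?c ^^ j = ?c \<circ> (?c ^^ j \<circ> \<sigma>)"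
    using Suc by (metis o_assoc)
  moreover have "(kreweras n ^^ (2 * Suc j)) \<sigma> = kreweras n (kreweras n ?t)"
    by simp
  ultimately show ?case by (simp only: funpow.simps o_assoc)
qed


section \<open>Orbits of size 1 and 2\<close>

lemma kreweras_twice_eq_self_iff:
  assumes "n \<ge> 1" "\<sigma> \<in> Sn n"
  shows "kreweras n (kreweras n \<sigma>) = \<sigma> \<longleftrightarrow> (\<exists>k\<in>{1..n}. \<sigma> = long_cycle n ^^ k)"
proof
  assume "kreweras n (kreweras n \<sigma>) = \<sigma>"
  then have "long_cycle n \<circ> \<sigma> = \<sigma> \<circ> long_cycle n"
    using kreweras_funpow_double[OF assms, of 1] by (simp add: numeral_2_eq_2)
  then have "\<sigma> = long_cycle n ^^ \<sigma> n"
    using assms by (intro commutes_long_cycle_imp_funpow) (auto simp: Sn_def)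
  moreover have "\<sigma> n \<in> {1..n}"
    using assms permutes_in_image[of \<sigma> "{1..n}" n] by (auto simp: Sn_def)
  ultimately show "\<exists>k\<in>{1..n}. \<sigma> = long_cycle n ^^ k" by blast
next
  assume "\<exists>k\<in>{1..n}. \<sigma> = long_cycle n ^^ k"
  then obtain k where k: "k \<in> {1..n}" "\<sigma> = long_cycle n ^^ k" by blast
  \<comment> \<open>The complement acts on exponents by the reflection
    \<open>k \<mapsto> n + 1 - k\<close> of \<open>{1..n}\<close>, an involution.\<close>
  then have "n + 1 - k \<in> {1..n}" "n + 1 - (n + 1 - k) = k" by auto
  then show "kreweras n (kreweras n \<sigma>) = \<sigma>"
    using k by (simp only: kreweras_long_cycle_funpow)
qed

lemma kreweras_long_cycle_funpow_eq_self_iff: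
  assumes "k \<in> {1..n}"
  shows "kreweras n (long_cycle n ^^ k) = long_cycle n ^^ k \<longleftrightarrow> 2 * k = n + 1"
proof -
  have "n + 1 - k \<in> {1..n}" using assms by auto
  then have "kreweras n (long_cycle n ^^ k) = long_cycle n ^^ k \<longleftrightarrow> n + 1 - k = k"
    unfolding kreweras_long_cycle_funpow[OF assms]
    using inj_on_eq_iff[OF inj_on_long_cycle_funpow] assms by metis
  then show ?thesis using assms by auto
qed

lemma kreweras_eq_self_iff:
  assumes "n \<ge> 1" "\<sigma> \<in> Sn n"
  shows "kreweras n \<sigma> = \<sigma> \<longleftrightarrow> odd n \<and> \<sigma> = long_cycle n ^^ ((n + 1) div 2)"
proof
  assume fixed: "kreweras n \<sigma> = \<sigma>"
  then obtain k where k: "k \<in> {1..n}" "\<sigma> = long_cycle n ^^ k"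
    using kreweras_twice_eq_self_iff[OF assms] by auto
  then have "2 * k = n + 1"
    using kreweras_long_cycle_funpow_eq_self_iff fixed by blast
  then have "odd n" "(n + 1) div 2 = k" by presburger+
  then show "odd n \<and> \<sigma> = long_cycle n ^^ ((n + 1) div 2)"
    using k by simp
next
  assume "odd n \<and> \<sigma> = long_cycle n ^^ ((n + 1) div 2)"
  then show "kreweras n \<sigma> = \<sigma>"
    using kreweras_long_cycle_funpow_eq_self_iff[of "(n + 1) div 2" n] assms(1) by auto
qed

lemma kreweras_orbits_card_1:
  assumes "n \<ge> 1"
  shows "{X \<in> orbits_on (kreweras n) (Sn n). card X = 1} =
    (if odd n then {{long_cycle n ^^ ((n + 1) div 2)}} else {})"
proof -
  have "{X \<in> orbits_on (kreweras n) (Sn n). card X = 1} =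
      orbit (kreweras n) ` {\<sigma> \<in> Sn n. kreweras n \<sigma> = \<sigma>}"
    using card_orbit_eq_1_iff[OF self_in_orbit_kreweras[OF assms]] unfolding orbits_on_def by blast
  also have "{\<sigma> \<in> Sn n. kreweras n \<sigma> = \<sigma>} = (if odd n then {long_cycle n ^^ ((n + 1) div 2)} else {})"
    using kreweras_eq_self_iff[OF assms] long_cycle_funpow_permutes[OF assms]
    unfolding Sn_def mem_Collect_eq by (simp only: split: if_splits) blast
  finally show ?thesis
    using kreweras_eq_self_iff[OF assms, of "long_cycle n ^^ ((n + 1) div 2)"]
      long_cycle_funpow_permutes[OF assms]
    by (auto simp add: Sn_def orbit_eq_singleton_iff simp del: One_nat_def)
qed

lemma kreweras_orbits_card_2:
  assumes "n \<ge> 1"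
  shows "{X \<in> orbits_on (kreweras n) (Sn n). card X = 2} =
    (\<lambda>k. {long_cycle n ^^ k, long_cycle n ^^ (n + 1 - k)}) ` {1..n div 2}" (is "?L = ?R")
proof -
  let ?P = "\<lambda>k. {long_cycle n ^^ k, long_cycle n ^^ (n + 1 - k)}"
  have orb: "orbit (kreweras n) (long_cycle n ^^ k) = ?P k" if "k \<in> {1..n}" for k
  proof -
    have "kreweras n (kreweras n (long_cycle n ^^ k)) = long_cycle n ^^ k"
      using that kreweras_twice_eq_self_iff[OF assms] long_cycle_funpow_permutes[OF assms]
      unfolding Sn_def by blast
    then show ?thesis
      using orbit_involutive kreweras_long_cycle_funpow[OF that] by metis
  qed
  have L: "?L = orbit (kreweras n) ` {\<sigma> \<in> Sn n. kreweras n (kreweras n \<sigma>) = \<sigma> \<and> kreweras n \<sigma> \<noteq> \<sigma>}"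
    using card_orbit_eq_2_iff[OF self_in_orbit_kreweras[OF assms]] unfolding orbits_on_def by blast
  have fixed: "{\<sigma> \<in> Sn n. kreweras n (kreweras n \<sigma>) = \<sigma> \<and> kreweras n \<sigma> \<noteq> \<sigma>} =
      (\<lambda>k. long_cycle n ^^ k) ` {k \<in> {1..n}. 2 * k \<noteq> n + 1}" (is "?A = ?B")
  proof (intro equalityI subsetI)
    fix \<sigma> assume \<sigma>: "\<sigma> \<in> ?A"
    then obtain k where k: "k \<in> {1..n}" "\<sigma> = long_cycle n ^^ k"
      using kreweras_twice_eq_self_iff[OF assms] by blast
    then have "2 * k \<noteq> n + 1"
      using \<sigma> kreweras_long_cycle_funpow_eq_self_iff[OF k(1)] by blast
    then show "\<sigma> \<in> ?B" using k by blast
  next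
    fix \<sigma> assume "\<sigma> \<in> ?B"
    then obtain k where k: "k \<in> {1..n}" "2 * k \<noteq> n + 1" "\<sigma> = long_cycle n ^^ k"
      by blast
    moreover have "\<sigma> \<in> Sn n"
      unfolding k(3) Sn_def using long_cycle_funpow_permutes[OF assms] by blast
    ultimately show "\<sigma> \<in> ?A"
      using kreweras_twice_eq_self_iff[OF assms] kreweras_long_cycle_funpow_eq_self_iff[OF k(1)]
      by blast
  qed
  have "orbit (kreweras n) ` (\<lambda>k. long_cycle n ^^ k) ` {k \<in> {1..n}. 2 * k \<noteq> n + 1} =
      ?P ` {k \<in> {1..n}. 2 * k \<noteq> n + 1}"
    unfolding image_image by (rule image_cong[OF refl], rule orb) blast
  \<comment> \<open>The reflection swaps the exponents up to \<open>n div 2\<close> with those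
    above, apart from the excluded midpoint, so the lower half already yields every pair.\<close>
  also have "\<dots> = ?R"
  proof (rule equalityI)
    show "?P ` {k \<in> {1..n}. 2 * k \<noteq> n + 1} \<subseteq> ?R"
    proof (rule image_subsetI)
      fix k assume k: "k \<in> {k \<in> {1..n}. 2 * k \<noteq> n + 1}"
      show "?P k \<in> ?R"
      proof (cases "k \<le> n div 2")
        case True
        with k have "k \<in> {1..n div 2}" by auto
        then show ?thesis by (rule imageI)
      next
        case False
        with k have "n + 1 - k \<in> {1..n div 2}" by auto
        moreover have "n + 1 - (n + 1 - k) = k" using k by auto
        then have "?P k = ?P (n + 1 - k)" by (simp only: insert_commute)
        ultimately show ?thesis by (rule rev_image_eqI)
      qed
    qed
    show "?R \<subseteq> ?P ` {k \<in> {1..n}. 2 * k \<noteq> n + 1}"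
      by (rule image_mono) auto
  qed
  finally show ?thesis
    unfolding L fixed .
qed

lemma card_kreweras_orbits_card_2:
  assumes "n \<ge> 1"
  shows "card {X \<in> orbits_on (kreweras n) (Sn n). card X = 2} = n div 2"
proof -
  have "inj_on (\<lambda>k. {long_cycle n ^^ k, long_cycle n ^^ (n + 1 - k)}) {1..n div 2}"
  proof (rule inj_onI)
    fix k l assume kl: "k \<in> {1..n div 2}" "l \<in> {1..n div 2}"
      and eq: "{long_cycle n ^^ k, long_cycle n ^^ (n + 1 - k)} =
        {long_cycle n ^^ l, long_cycle n ^^ (n + 1 - l)}"
    have ran: "k \<in> {1..n}" "l \<in> {1..n}" "n + 1 - l \<in> {1..n}"
      using kl by auto
    have "long_cycle n ^^ k = long_cycle n ^^ l \<or> long_cycle n ^^ k = long_cycle n ^^ (n + 1 - l)"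
      using eq by blast
    then have "k = l \<or> k = n + 1 - l"
      using inj_on_eq_iff[OF inj_on_long_cycle_funpow] ran by metis
    \<comment> \<open>The second alternative would give \<open>k + l = n + 1\<close>, but both are
      at most \<open>n div 2\<close>.\<close>
    then show "k = l" using kl by auto
  qed
  then show ?thesis
    unfolding kreweras_orbits_card_2[OF assms] by (simp add: card_image)
qed

lemma orbit_kreweras_id:
  assumes "n \<ge> 2"
  shows "orbit (kreweras n) id \<in> {X \<in> orbits_on (kreweras n) (Sn n). card X = 2}"
proof -
  have n: "n \<ge> 1" using assms by simp
  \<comment> \<open>The exponent of the identity is taken as n, not 0, to lie in
    \<open>{1..n}\<close>; it is no midpoint because \<open>2 * n \<noteq> n + 1\<close>.\<close>
  have id: "id = long_cycle n ^^ n" "id \<in> Sn n"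
    using long_cycle_funpow_eq_id[OF n, of n] by (auto simp: Sn_def permutes_id)
  have "kreweras n (kreweras n id) = id"
    using kreweras_twice_eq_self_iff[OF n id(2)] id(1) n by force
  moreover have "kreweras n id \<noteq> id"
    using kreweras_long_cycle_funpow_eq_self_iff[of n n] assms id(1) by auto
  ultimately show ?thesis
    using card_orbit_eq_2_iff[OF self_in_orbit_kreweras[OF n id(2)]] id(2)
    by (simp add: orbits_on_def)
qed

section \<open>Rotations and the reversal in one-line notation\<close>

lemma one_line_in_Sn:
  assumes "length w = n" "distinct w" "set w \<subseteq> {1..n}"
  shows "one_line w \<in> Sn n"
proof -
  have "inj_on (one_line w) {1..n}"
    using assms by (auto simp: inj_on_def one_line_def nth_eq_iff_index_eq)
  moreover have "one_line w ` {1..n} \<subseteq> {1..n}"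
    using assms nth_mem[of _ w] by (fastforce simp: one_line_def)
  ultimately have "bij_betw (one_line w) {1..n} {1..n}"
    by (simp add: bij_betw_def endo_inj_surj)
  then show ?thesis
    using assms(1) by (auto simp: Sn_def one_line_def intro: bij_imp_permutes)
qed

lemma one_line_rotation:
  assumes "k \<in> {1..n}"
  shows "one_line ([k + 1..<n + 1] @ [1..<k + 1]) = long_cycle n ^^ k"
proof (rule permutes_atLeastAtMost_eqI[of _ n])
  have "one_line ([k + 1..<n + 1] @ [1..<k + 1]) \<in> Sn n"
    using assms by (intro one_line_in_Sn) auto
  then show "one_line ([k + 1..<n + 1] @ [1..<k + 1]) permutes {1..n}"
    by (simp only: Sn_def mem_Collect_eq)
  show "(long_cycle n ^^ k) permutes {1..n}"
    using assms by (intro long_cycle_funpow_permutes) auto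
  fix i assume i: "i \<in> {1..n}"
  have "[one_line ([k + 1..<n + 1] @ [1..<k + 1]) i = i + k] (mod n)"
  proof (cases "i \<le> n - k")
    case True
    then have "i - 1 < n - k" using i by auto
    then have "one_line ([k + 1..<n + 1] @ [1..<k + 1]) i = i + k"
      using i assms by (simp add: one_line_def nth_append del: upt_Suc)
    then show ?thesis by simp
  next
    case False
    then have "\<not> i - 1 < n - k" by auto
    \<comment> \<open>Past position \<open>n - k\<close> the entries have wrapped around: they are
      smaller than \<open>i + k\<close> by exactly n.\<close>
    then have "one_line ([k + 1..<n + 1] @ [1..<k + 1]) i + n = i + k"
      using i assms False by (simp add: one_line_def nth_append del: upt_Suc)
    then show ?thesis by (metis cong_def mod_add_self2)
  qed
  then show "[one_line ([k + 1..<n + 1] @ [1..<k + 1]) i = (long_cycle n ^^ k) i] (mod n)"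
    using long_cycle_funpow_cong[OF i] cong_sym cong_trans by blast
qed

lemma card_orbit_kreweras_reversal:
  assumes "n \<ge> 1" "\<rho> \<in> Sn n" "\<And>i. i \<in> {1..n} \<Longrightarrow> \<rho> i = n + 1 - i"
  shows "card (orbit (kreweras n) \<rho>) = n"
proof -
  let ?c = "long_cycle n"
  have perm: "(?c ^^ m \<circ> \<rho>) permutes {1..n}" for m
    using assms(1,2) unfolding Sn_def mem_Collect_eq
    by (intro permutes_compose long_cycle_funpow_permutes)
  \<comment> \<open>A point and its image have constant sum \<open>m + 1\<close> modulo n. This
    condition is symmetric in the two, which makes the map an involution.\<close>
  have val: "[(?c ^^ m \<circ> \<rho>) i + i = m + 1] (mod n)" if "i \<in> {1..n}" for m i
  proof -
    have "n + 1 - i \<in> {1..n}" using that by auto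
    from cong_add[OF long_cycle_funpow_cong[OF this, of m] cong_refl[of i]]
    have "[(?c ^^ m \<circ> \<rho>) i + i = n + 1 - i + m + i] (mod n)"
      using assms(3)[OF that] by simp
    also have "n + 1 - i + m + i = (m + 1) + n" using that by auto
    also have "[(m + 1) + n = m + 1] (mod n)" by (simp only: cong_def mod_add_self2)
    finally show ?thesis .
  qed
  \<comment> \<open>Each \<open>c\<^sup>m \<circ> \<rho>\<close> is a reflection of the \<open>n\<close>-gon, hence its own inverse.\<close>
  have invol: "(?c ^^ m \<circ> \<rho>) \<circ> (?c ^^ m \<circ> \<rho>) = id" for m
  proof (rule permutes_atLeastAtMost_eqI[of _ n])
    fix i assume i: "i \<in> {1..n}"
    let ?r = "?c ^^ m \<circ> \<rho>"
    have "?r i \<in> {1..n}"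
      using i perm by (simp only: permutes_in_image)
    from val[OF this, of m] have "[?r (?r i) + ?r i = i + ?r i] (mod n)"
      using val[OF i, of m] by (metis add.commute cong_sym cong_trans)
    then show "[(?r \<circ> ?r) i = id i] (mod n)"
      by (simp add: cong_add_rcancel_nat)
  qed (rule permutes_compose[OF perm perm] permutes_id)+
  \<comment> \<open>On a self-inverse permutation the complement is just composition with c, so each
    application raises m by one.\<close>
  have pow: "(kreweras n ^^ m) \<rho> = ?c ^^ m \<circ> \<rho>" for m
  proof (induction m)
    case (Suc m)
    have "inv (?c ^^ m \<circ> \<rho>) = ?c ^^ m \<circ> \<rho>"
      using invol by (intro inv_unique_comp)
    then have "kreweras n (?c ^^ m \<circ> \<rho>) = ?c ^^ Suc m \<circ> \<rho>"
      by (simp add: kreweras_def o_assoc)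
    then show ?case
      unfolding funpow.simps(2)[of m "kreweras n"] comp_apply[of "kreweras n"] Suc .
  qed simp
  \<comment> \<open>An earlier return would make the m-th power of c fix
    \<open>\<rho> 1 = n\<close>, but it sends n to m.\<close>
  have "(?c ^^ m \<circ> \<rho>) \<noteq> \<rho>" if "0 < m" "m < n" for m
  proof
    assume "?c ^^ m \<circ> \<rho> = \<rho>"
    then have "(?c ^^ m) (\<rho> 1) = \<rho> 1" by (auto dest: fun_cong[of _ _ 1])
    moreover have "\<rho> 1 = n" using assms by simp
    ultimately show False
      using long_cycle_funpow_last[of m n] that by simp
  qed
  moreover have "?c ^^ n \<circ> \<rho> = \<rho>"
    using long_cycle_funpow_eq_id[OF assms(1), of n] by simp
  ultimately show ?thesis
    using card_orbit_eq_iff[OF self_in_orbit_kreweras[OF assms(1,2)], of n] assms(1) pow by simp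
qed

section \<open>Orbits of size 2n\<close>

lemma card_orbit_kreweras_maximal:
  assumes "n \<ge> 1" "\<sigma> \<in> Sn n"
    and comm: "\<And>j. long_cycle n ^^ j \<circ> \<sigma> = \<sigma> \<circ> long_cycle n ^^ j \<Longrightarrow> n dvd j"
    and odd: "\<And>j. long_cycle n ^^ (j + 1) \<noteq> \<sigma> \<circ> long_cycle n ^^ j \<circ> \<sigma>"
  shows "card (orbit (kreweras n) \<sigma>) = 2 * n"
proof -
  let ?c = "long_cycle n"
  have "(kreweras n ^^ m) \<sigma> \<noteq> \<sigma>" if "0 < m" "m < 2 * n" for m
  proof
    assume fixed: "(kreweras n ^^ m) \<sigma> = \<sigma>"
    show False
    proof (cases "even m")
      case True
      then obtain j where m: "m = 2 * j" by blast
      then have "?c ^^ j \<circ> \<sigma> = \<sigma> \<circ> ?c ^^ j"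
        using kreweras_funpow_double[OF assms(1,2), of j] fixed by simp
      from comm[OF this] show False using m that by (auto dest: dvd_imp_le)
    next
      case False
      then obtain j where m: "m = Suc (2 * j)" using oddE by fastforce
      \<comment> \<open>Splitting off one application leaves an even iterate at
        \<open>kreweras n \<sigma>\<close>, to which the conjugation formula applies; composing with
        \<open>\<sigma>\<close> on the right then cancels \<open>inv \<sigma>\<close>.\<close>
      have "(kreweras n ^^ (2 * j)) (kreweras n \<sigma>) = \<sigma>"
        using fixed m by (simp add: funpow_swap1)
      then have "\<sigma> \<circ> ?c ^^ j = ?c ^^ j \<circ> (?c \<circ> inv \<sigma>)"
        using kreweras_funpow_double[OF assms(1) kreweras_in_Sn[OF assms(1,2)], of j]
        by (simp add: kreweras_def)
      then have "\<sigma> \<circ> ?c ^^ j \<circ> \<sigma> = ?c ^^ j \<circ> ?c \<circ> (inv \<sigma> \<circ> \<sigma>)"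
        by (simp add: o_assoc)
      moreover have "inv \<sigma> \<circ> \<sigma> = id"
        using assms(2) by (simp add: Sn_def permutes_inv_o)
      ultimately have "\<sigma> \<circ> ?c ^^ j \<circ> \<sigma> = ?c ^^ (j + 1)"
        by (simp add: funpow_Suc_right del: funpow.simps)
      then show False using odd by metis
    qed
  qed
  moreover have "(kreweras n ^^ (2 * n)) \<sigma> = \<sigma>"
    using kreweras_funpow_double[OF assms(1,2), of n] long_cycle_funpow_eq_id[OF assms(1), of n]
    by simp
  ultimately show ?thesis
    using card_orbit_eq_iff[OF self_in_orbit_kreweras[OF assms(1,2)], of "2 * n"] assms(1) by simp
qed

text \<open>One formula for both parities: half of n rounded up counts the odd numbers in
  \<open>{1..n}\<close>, rounded down the even ones.\<close>

definition unshuffle :: "nat \<Rightarrow> nat \<Rightarrow> nat" where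
  "unshuffle n = one_line (map (\<lambda>i. 2 * i - 1) [1..<(n + 1) div 2 + 1]
                           @ map (\<lambda>i. 2 * i) [1..<n div 2 + 1])"

lemma unshuffle_in_Sn: "unshuffle n \<in> Sn n"
  unfolding unshuffle_def
proof (rule one_line_in_Sn)
  have "2 * i - 1 \<noteq> 2 * j" if "i \<ge> 1" for i j :: nat
    using that by presburger
  then show "distinct (map (\<lambda>i. 2 * i - 1) [1..<(n + 1) div 2 + 1] @ map (\<lambda>i. 2 * i) [1..<n div 2 + 1])"
    by (auto simp: distinct_map inj_on_def)
qed auto

lemma unshuffle_eq:
  assumes "i \<in> {1..n}"
  shows "unshuffle n i = (if i \<le> (n + 1) div 2 then 2 * i - 1 else 2 * (i - (n + 1) div 2))"
proof (cases "i \<le> (n + 1) div 2")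
  case True
  then have "i - 1 < (n + 1) div 2" using assms by auto
  then show ?thesis
    using assms True by (simp add: unshuffle_def one_line_def nth_append del: upt_Suc)
next
  case False
  then have "i - 1 - (n + 1) div 2 < n div 2" "i \<le> (n + 1) div 2 + n div 2"
    and "\<not> i - 1 < (n + 1) div 2" "i - (n + 1) div 2 = Suc (i - 1 - (n + 1) div 2)"
    using assms by auto
  then show ?thesis
    using assms False by (simp add: unshuffle_def one_line_def nth_append del: upt_Suc)
qed

lemma unshuffle_commutes_long_cycle_funpow:
  assumes "n > 3" "long_cycle n ^^ j \<circ> unshuffle n = unshuffle n \<circ> long_cycle n ^^ j"
  shows "n dvd j"
proof -
  have comm: "(long_cycle n ^^ j) (unshuffle n i) = unshuffle n ((long_cycle n ^^ j) i)" for i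
    using fun_cong[OF assms(2), of i] by simp
  \<comment> \<open>The j-th power of c sends 1 to \<open>q + 1\<close>. As 1 is fixed by
    \<open>unshuffle n\<close>, commuting makes \<open>q + 1\<close> fixed too.\<close>
  define q where "q = j mod n"
  have q: "q < n" unfolding q_def using assms(1) by simp
  have "unshuffle n 1 = 1" using assms(1) by (simp add: unshuffle_eq)
  then have fixed: "unshuffle n (q + 1) = q + 1"
    using comm[of 1] assms(1) by (simp add: long_cycle_funpow q_def)
  \<comment> \<open>In the first block \<open>2 * i - 1 = i\<close> forces \<open>i = 1\<close>; in
    the second the fixed point is \<open>2 * ((n + 1) div 2)\<close>, which is n for even n and too
    large for odd n.\<close>
  have "q = 0 \<or> even n \<and> q + 1 = n"
  proof (cases "q + 1 \<le> (n + 1) div 2")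
    case True
    then show ?thesis using fixed q by (simp add: unshuffle_eq)
  next
    case False
    then have "2 * (q + 1 - (n + 1) div 2) = q + 1"
      using fixed q by (simp add: unshuffle_eq)
    then show ?thesis using q False by presburger
  qed
  \<comment> \<open>Otherwise the power is the inverse of c. At 2 the two sides then differ: 2 goes
    to 3 and back to 2, or to 1 and stays there.\<close>
  moreover have "q + 1 \<noteq> n"
  proof
    assume "q + 1 = n"
    then have "(1 + j) mod n = 0" "(2 + j) mod n = 1"
      using assms(1) unfolding q_def by (simp_all add: mod_Suc)
    then have "(long_cycle n ^^ j) 2 = 1" "(long_cycle n ^^ j) 3 = 2"
      using assms(1) by (simp_all add: long_cycle_funpow)
    moreover have "unshuffle n 2 = 3" using assms(1) by (simp add: unshuffle_eq)
    ultimately show False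
      using comm[of 2] \<open>unshuffle n 1 = 1\<close> by simp
  qed
  ultimately show ?thesis unfolding q_def by auto
qed

text \<open>For odd n the second block has the entries \<open>2 * i - 1 - n\<close>, so one affine
  formula modulo n covers both blocks. The 1 stands on the left to avoid truncated
  subtraction.\<close>

lemma unshuffle_odd_cong:
  assumes "odd n" "i \<in> {1..n}"
  shows "[unshuffle n i + 1 = 2 * i] (mod n)"
proof (cases "i \<le> (n + 1) div 2")
  case True
  then show ?thesis using assms by (simp add: unshuffle_eq)
next
  case False
  then have "unshuffle n i + 1 + n = 2 * i"
    using assms by (auto simp: unshuffle_eq elim!: oddE)
  then show ?thesis by (metis cong_add_rcancel_0_nat cong_def mod_add_self2)
qed

lemma long_cycle_funpow_neq_unshuffle_sandwich:
  assumes "n > 3"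
  shows "long_cycle n ^^ (j + 1) \<noteq> unshuffle n \<circ> long_cycle n ^^ j \<circ> unshuffle n"
proof
  let ?c = "long_cycle n" and ?u = "unshuffle n"
  assume eq: "?c ^^ (j + 1) = ?u \<circ> ?c ^^ j \<circ> ?u"
  show False
  proof (cases "even n")
    case True
    \<comment> \<open>\<open>c\<^bsup>2j+1\<^esup>\<close> equals both \<open>u \<circ> w\<close> and \<open>w \<circ> u\<close> for \<open>w = c\<^sup>j \<circ> u \<circ> c\<^sup>j\<close>, so it commutes with \<open>u\<close>.\<close>
    define w where "w = ?c ^^ j \<circ> ?u \<circ> ?c ^^ j"
    have "?c ^^ (2 * j + 1) = ?c ^^ (j + 1) \<circ> ?c ^^ j"
      by (simp only: flip: funpow_add) (simp add: mult_2)
    then have uw: "?c ^^ (2 * j + 1) = ?u \<circ> w"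
      unfolding eq w_def by (simp only: o_assoc)
    have "?c ^^ (2 * j + 1) = ?c ^^ j \<circ> ?c ^^ (j + 1)"
      by (simp only: flip: funpow_add) (simp add: mult_2)
    then have wu: "?c ^^ (2 * j + 1) = w \<circ> ?u"
      unfolding eq w_def by (simp only: o_assoc)
    have "?c ^^ (2 * j + 1) \<circ> ?u = ?u \<circ> (w \<circ> ?u)"
      unfolding uw by (simp only: o_assoc)
    then have "?c ^^ (2 * j + 1) \<circ> ?u = ?u \<circ> ?c ^^ (2 * j + 1)"
      unfolding wu .
    then have "n dvd 2 * j + 1"
      by (rule unshuffle_commutes_long_cycle_funpow[OF assms])
    \<comment> \<open>An even n cannot divide an odd number.\<close>
    then show False
      using True dvd_trans[of 2 n "2 * j + 1"] by simp
  next
    case False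
    \<comment> \<open>Evaluating \<open>eq\<close> at x gives \<open>x + j + 1\<close> on one side
      and 2((2x - 1) + j) - 1 on the other; adding 3 clears the subtractions, 1 for the outer
      \<open>unshuffle n\<close> and 2 for the doubled inner one.\<close>
    have main: "[x + j + 4 = 4 * x + 2 * j] (mod n)" if x: "x \<in> {1..n}" for x
    proof -
      define y where "y = ?u x"
      define z where "z = (?c ^^ j) y"
      have y: "y \<in> {1..n}"
        using x unshuffle_in_Sn[of n] unfolding y_def Sn_def mem_Collect_eq
        by (simp only: permutes_in_image)
      have z: "z \<in> {1..n}"
        using y long_cycle_funpow_permutes[of n j] assms unfolding z_def
        by (simp only: permutes_in_image)
      have "?u z = (?c ^^ (j + 1)) x"
        unfolding eq by (simp add: y_def z_def)
      then have "[?u z = x + (j + 1)] (mod n)"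
        by (simp only: long_cycle_funpow_cong[OF x])
      then have "[x + (j + 1) + 3 = ?u z + 3] (mod n)"
        by (rule cong_add[OF cong_sym cong_refl])
      then have "[x + j + 4 = (?u z + 1) + 2] (mod n)"
        by (simp add: eval_nat_numeral)
      also have "[(?u z + 1) + 2 = 2 * z + 2] (mod n)"
        using unshuffle_odd_cong[OF False z] by (intro cong_add cong_refl)
      also have "[2 * z + 2 = 2 * (y + j) + 2] (mod n)"
        using long_cycle_funpow_cong[OF y, of j] unfolding z_def by (intro cong_add cong_mult cong_refl)
      also have "2 * (y + j) + 2 = 2 * (y + 1) + 2 * j" by simp
      also have "[2 * (y + 1) + 2 * j = 2 * (2 * x) + 2 * j] (mod n)"
        using unshuffle_odd_cong[OF False x] unfolding y_def by (intro cong_add cong_mult cong_refl)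
      finally show ?thesis by simp
    qed
    \<comment> \<open>From x = 1 to x = 2 the left side of \<open>main\<close> grows by 1 and the
      right side by 4, so n would divide 3.\<close>
    have "[1 + j + 4 + 4 = 4 * 1 + 2 * j + 4] (mod n)"
      by (rule cong_add[OF main cong_refl]) (use assms in auto)
    also have "4 * 1 + 2 * j + 4 = 4 * 2 + 2 * j" by simp
    also have "[4 * 2 + 2 * j = 2 + j + 4] (mod n)"
      by (rule cong_sym[OF main]) (use assms in auto)
    finally have "[3 + (j + 6) = 0 + (j + 6)] (mod n)" by (simp add: add.commute)
    then have "[3 = 0] (mod n)" by (simp only: cong_add_rcancel_nat)
    then show False using assms by (simp add: cong_def)
  qed
qed

lemma card_orbit_kreweras_unshuffle: "n > 3 \<Longrightarrow> card (orbit (kreweras n) (unshuffle n)) = 2 * n"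
  by (rule card_orbit_kreweras_maximal)
    (use unshuffle_in_Sn unshuffle_commutes_long_cycle_funpow long_cycle_funpow_neq_unshuffle_sandwich
      in auto)

theorem theorem7p9:
  fixes n :: nat and K :: "(nat \<Rightarrow> nat) \<Rightarrow> (nat \<Rightarrow> nat)"
  assumes "n \<ge> 2"
    and "K = kreweras n \<or> K = kreweras_inv n"
  shows "(odd n \<longrightarrow>
      (let \<sigma> = one_line ([(n + 3) div 2..<n + 1] @ [1..<(n + 1) div 2 + 1])
       in \<sigma> \<in> Sn n \<and> {X \<in> orbits_on K (Sn n). card X = 1} = {{\<sigma>}}))
    \<and> (even n \<longrightarrow> \<not> (\<exists>X \<in> orbits_on K (Sn n). card X = 1))
    \<and> card {X \<in> orbits_on K (Sn n). card X = 2} = n div 2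
    \<and> orbit K id \<in> {X \<in> orbits_on K (Sn n). card X = 2}
    \<and> (let \<sigma> = one_line (rev [1..<n + 1])
       in \<sigma> \<in> Sn n \<and> card (orbit K \<sigma>) = n)
    \<and> (even n \<and> n > 3 \<longrightarrow>
      (let \<sigma> = one_line (map (\<lambda>i. 2 * i - 1) [1..<n div 2 + 1]
                         @ map (\<lambda>i. 2 * i) [1..<n div 2 + 1])
       in \<sigma> \<in> Sn n \<and> card (orbit K \<sigma>) = 2 * n))
    \<and> (odd n \<and> n > 3 \<longrightarrow>
      (let \<sigma> = one_line (map (\<lambda>i. 2 * i - 1) [1..<(n + 1) div 2 + 1]
                         @ map (\<lambda>i. 2 * i) [1..<(n - 1) div 2 + 1])
       in \<sigma> \<in> Sn n \<and> card (orbit K \<sigma>) = 2 * n))"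
proof -
  have n: "n \<ge> 1" using assms(1) by simp
  \<comment> \<open>Both choices of \<open>K\<close> have the same orbits on \<open>Sn n\<close>, so
    only \<open>kreweras n\<close> has to be treated.\<close>
  have orb: "orbit K \<sigma> = orbit (kreweras n) \<sigma>" if "\<sigma> \<in> Sn n" for \<sigma>
    using assms(2) orbit_kreweras_inv[OF n that] by auto
  have orbs: "orbits_on K (Sn n) = orbits_on (kreweras n) (Sn n)"
    unfolding orbits_on_def by (rule image_cong) (use orb in auto)
  let ?\<tau> = "long_cycle n ^^ ((n + 1) div 2)" and ?\<rho> = "one_line (rev [1..<n + 1])"
  have tau: "one_line ([(n + 3) div 2..<n + 1] @ [1..<(n + 1) div 2 + 1]) = ?\<tau>"
  proof -
    have "(n + 3) div 2 = (n + 1) div 2 + 1" "(n + 1) div 2 \<in> {1..n}"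
      using n by auto
    then show ?thesis using one_line_rotation by metis
  qed
  have tau_Sn: "?\<tau> \<in> Sn n"
    using long_cycle_funpow_permutes[OF n] by (simp add: Sn_def)
  have id: "id \<in> Sn n" by (simp add: Sn_def permutes_id)
  have rho: "?\<rho> \<in> Sn n" by (rule one_line_in_Sn) auto
  have rho_card: "card (orbit (kreweras n) ?\<rho>) = n"
    by (rule card_orbit_kreweras_reversal[OF n rho])
      (auto simp: one_line_def rev_nth simp del: upt_Suc)
  have even: "one_line (map (\<lambda>i. 2 * i - 1) [1..<n div 2 + 1] @ map (\<lambda>i. 2 * i) [1..<n div 2 + 1])
      = unshuffle n" if "even n"
  proof -
    have "n div 2 = (n + 1) div 2" using that by presburger
    then show ?thesis unfolding unshuffle_def by metis
  qed
  have odd: "one_line (map (\<lambda>i. 2 * i - 1) [1..<(n + 1) div 2 + 1]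
      @ map (\<lambda>i. 2 * i) [1..<(n - 1) div 2 + 1]) = unshuffle n" if "odd n"
  proof -
    have "(n - 1) div 2 = n div 2" using that by presburger
    then show ?thesis unfolding unshuffle_def by metis
  qed
  have u: "unshuffle n \<in> Sn n \<and> card (orbit K (unshuffle n)) = 2 * n" if "n > 3"
    using card_orbit_kreweras_unshuffle[OF that] unshuffle_in_Sn orb by simp
  show ?thesis
    unfolding Let_def tau orbs orb[OF id] orb[OF rho]
  proof (intro conjI impI)
    show "?\<tau> \<in> Sn n" by (rule tau_Sn)
    show "{X \<in> orbits_on (kreweras n) (Sn n). card X = 1} = {{?\<tau>}}" if "odd n"
      using kreweras_orbits_card_1[OF n] that by presburger
    show "\<not> (\<exists>X\<in>orbits_on (kreweras n) (Sn n). card X = 1)" if "even n"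
      using kreweras_orbits_card_1[OF n] that by auto
    show "card {X \<in> orbits_on (kreweras n) (Sn n). card X = 2} = n div 2"
      by (rule card_kreweras_orbits_card_2[OF n])
    show "orbit (kreweras n) id \<in> {X \<in> orbits_on (kreweras n) (Sn n). card X = 2}"
      by (rule orbit_kreweras_id[OF assms(1)])
    show "?\<rho> \<in> Sn n" "card (orbit (kreweras n) ?\<rho>) = n"
      by (rule rho rho_card)+
  qed (use even odd u in \<open>metis (no_types)\<close>)+
qed

end
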